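(* Let $0<q<1$ and let $w$ be a weight on the exponential lattice $\{q^k \mid k\in\mathbb{N}_0\}$ with $w(0)=w(1/q)=0$, whose potential $u$, defined by $-u(qx)w(qx)=D_qw(x)$, is $$u(x)=\frac{k_1 q}{1-q}\,\frac1x+\frac{k_2x+k_3}{1-q},\qquad k_1\neq 0,\ k_2\neq 0 .$$ Let $\{p_n\}_{n\ge 0}$ be the orthonormal polynomials with respect to $w$, with recurrence coefficients $a_n,b_n$ in $xp_n(x)=a_{n+1}p_{n+1}(x)+b_np_n(x)+a_np_{n-1}(x)$, and let $$R_n=-k_1\int_0^1 p_n(y)p_n(y/q)\frac{w(y)}{y}\,d_qy,\qquad r_n=-a_nk_1\int_0^1 p_n(y)p_{n-1}(y/q)\frac{w(y)}{y}\,d_qy,\qquad r_0=0.$$ For $n\ge 1$ put $$f_n=-\frac{k_2q^{-1-n}\,r_n(r_n+k_1)\big(r_n(q^n-1-r_{n+1})+(q^n-1)(r_{n+1}+k_1)\big)}{(q^n-1-r_n)\big(r_{n-1}(q^n-1-r_n)+(q^n-1)(r_n+k_1)\big)},$$ $$g_n=-k_2q^{-2n-1}\big((1+r_n)(1+r_{n+1})-(1-k_1)\big).$$ Then the recurrence coefficients are expressed in terms of the sequence $(r_n)$ by $$a_n^2=\frac{q^n(1-q^n+r_n)}{k_2},\qquad r_{n+1}+r_n=-b_nR_n-k_1,\qquad R_n^2=f_n ,$$ and $(r_n)$ is a solution of the second order, second degree discrete equation (in $n$) $$f_n^2-2f_ng_n+g_n^2-k_3^2q^{-2n-2}f_n=0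 .$$ Here the relations involving $f_n$ are for all $n\ge 1$ for which the denominator in $f_n$ does not vanish.
   Context: The $q$-difference operator is $(D_qf)(x)=\frac{f(x)-f(qx)}{x(1-q)}$ for $x\ne 0$. The $q$-integral is $\int_0^1 f(x)\,d_qx=(1-q)\sum_{n=0}^\infty q^nf(q^n)$. A weight on $\{q^k\mid k\in\mathbb{N}_0\}$ is a function $w$, positive at the lattice points; $w(0)=0$ is understood as $\lim_{k\to\infty}w(q^k)=0$. The relation $-u(qx)w(qx)=D_qw(x)$ is required for $x=q^k$, $k\ge -1$ (with $w(1/q)=0$); equivalently $w(x)=(1-k_1-k_3x-k_2qx^2)\,w(qx)$ for these $x$. The constants $k_1,k_2,k_3$ are real. The orthonormal polynomials $p_n$ have degree exactly $n$, positive leading coefficient, and satisfy $\int_0^1p_m(x)p_n(x)w(x)\,d_qx=\delta_{m,n}$. Conventions: $p_{-1}=0$, $a_0=0$. *)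

theory Defs
  imports Complex_Main "HOL-Computational_Algebra.Polynomial"
begin

(* Only meaningful for x \<noteq> 0 and q \<noteq> 1. *)
definition q_diff :: "real \<Rightarrow> (real \<Rightarrow> real) \<Rightarrow> real \<Rightarrow> real" where
  "q_diff q f x = (f x - f (q * x)) / (x * (1 - q))"

(* The q-integral over [0,1]; only meaningful when the series converges. *)
definition q_integral :: "real \<Rightarrow> (real \<Rightarrow> real) \<Rightarrow> real" where
  "q_integral q f = (1 - q) * (\<Sum>n. q ^ n * f (q ^ n))"

(* w is a function on all of the reals, but only its values at q^k, k \<ge> -1, matter.
   The boundary value w(0) = 0 means the limit along the lattice. *)
definition q_weight :: "real \<Rightarrow> (real \<Rightarrow> real) \<Rightarrow> bool" where
  "q_weight q w \<longleftrightarrow>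
     (\<forall>k::nat. w (q ^ k) > 0) \<and> (\<lambda>k. w (q ^ k)) \<longlonglongrightarrow> 0 \<and> w (1 / q) = 0"

(* The lattice is extended by the point 1/q, i.e. k = -1. *)
definition q_potential :: "real \<Rightarrow> (real \<Rightarrow> real) \<Rightarrow> (real \<Rightarrow> real) \<Rightarrow> bool" where
  "q_potential q w u \<longleftrightarrow>
     (\<forall>k::int. k \<ge> -1 \<longrightarrow>
        - u (q * q powi k) * w (q * q powi k) = q_diff q w (q powi k))"

definition q_orthonormal :: "real \<Rightarrow> (real \<Rightarrow> real) \<Rightarrow> (nat \<Rightarrow> real poly) \<Rightarrow> bool" where
  "q_orthonormal q w p \<longleftrightarrow>
     (\<forall>n. degree (p n) = n \<and> lead_coeff (p n) > 0) \<and>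
     (\<forall>m n. q_integral q (\<lambda>x. poly (p m) x * poly (p n) x * w x) = (if m = n then 1 else 0))"

(* The case n = 0 encodes p_{-1} = 0. *)
definition recurrence_coeffs ::
  "(nat \<Rightarrow> real poly) \<Rightarrow> (nat \<Rightarrow> real) \<Rightarrow> (nat \<Rightarrow> real) \<Rightarrow> bool" where
  "recurrence_coeffs p a b \<longleftrightarrow> a 0 = 0 \<and>
     (\<forall>n x. x * poly (p n) x =
        a (n + 1) * poly (p (n + 1)) x + b n * poly (p n) x
          + a n * (if n = 0 then 0 else poly (p (n - 1)) x))"

end

theory Submission
  imports Defs
begin

text \<open>Since \<open>w\<close> decays, necessarily \<open>k\<^sub>1 < 0\<close>, so \<open>w\<close> decays geometrically and \<open>w(x)/x\<close> is
  \<open>q\<close>-integrable against polynomials. Write \<open>S F\<close> for the integral of \<open>F(x) w(x)/x\<close> and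
  \<open>L F = S (x F)\<close> for that of \<open>F(x) w(x)\<close>. As \<open>S (p\<^sub>n F) = F(0) S (p\<^sub>n)\<close> whenever \<open>deg F \<le> n\<close>,
  the auxiliary quantities factor: \<open>R\<^sub>n = - k\<^sub>1 p\<^sub>n(0) S (p\<^sub>n)\<close> and
  \<open>r\<^sub>n = - k\<^sub>1 a\<^sub>n p\<^sub>n\<^sub>-\<^sub>1(0) S (p\<^sub>n)\<close>. The sequences \<open>p\<^sub>n(0)\<close> and \<open>S (p\<^sub>n)\<close> solve the same recurrence
  for \<open>n \<ge> 1\<close>, and their Casoratian gives \<open>a\<^sub>n\<^sup>2 R\<^sub>n R\<^sub>n\<^sub>-\<^sub>1 = r\<^sub>n (r\<^sub>n + k\<^sub>1)\<close>. The Pearson equation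
  \<open>S (F(q x) G(x)) = S (\<psi>(x) F(x) G(x/q))\<close>, tested on the pairs \<open>(p\<^sub>n, p\<^sub>n\<^sub>-\<^sub>1)\<close>, \<open>(p\<^sub>n, p\<^sub>n)\<close> and
  \<open>(p\<^sub>n, x p\<^sub>n\<^sub>-\<^sub>1)\<close>, supplies the remaining relations, after the subleading coefficients of the
  polynomials are eliminated.\<close>

section \<open>Convergence of the weighted lattice series\<close>

text \<open>A limit \<open>l < 1\<close> would make \<open>v\<close> eventually nondecreasing,
  against decay to 0 from positive values. So \<open>l > 1\<close>, and the ratio test
  applies.\<close>

lemma summable_if_ratio_limit_neq_1:
  fixes v \<phi> :: "nat \<Rightarrow> real"
  assumes pos: "\<And>k. v k > 0" and lim: "v \<longlonglongrightarrow> 0"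
    and rec: "\<And>k. v k = \<phi> k * v (Suc k)"
    and phi: "\<phi> \<longlonglongrightarrow> l" and l: "l \<noteq> 1"
  shows "summable v"
proof -
  have "l > 1"
  proof (rule ccontr)
    assume "\<not> l > 1"
    then have "l < 1" using l by simp
    then have "eventually (\<lambda>k. \<phi> k < 1) sequentially"
      using phi order_tendstoD(2) by blast
    then obtain N where N: "\<And>k. k \<ge> N \<Longrightarrow> \<phi> k < 1"
      by (auto simp: eventually_sequentially)
    have step: "v k \<le> v (Suc k)" if "k \<ge> N" for k
    proof -
      have "\<phi> k * v (Suc k) \<le> 1 * v (Suc k)"
        using N[OF that] pos[of "Suc k"] by (intro mult_right_mono) auto
      then show ?thesis using rec[of k] by simp
    qed
    have "v N \<le> v k" if "k \<ge> N" for k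
      using that by (induction k rule: dec_induct) (auto intro: order_trans step)
    then have "v N \<le> 0"
      using LIMSEQ_le_const[OF lim, of "v N"] by blast
    then show False using pos[of N] by simp
  qed
  define c where "c = (1 + l) / 2"
  have c: "1 < c" "c < l" using \<open>l > 1\<close> by (auto simp: c_def)
  then have "eventually (\<lambda>k. c < \<phi> k) sequentially"
    using phi order_tendstoD(1) by blast
  then obtain N where N: "\<And>k. k \<ge> N \<Longrightarrow> c < \<phi> k"
    by (auto simp: eventually_sequentially)
  show ?thesis
  proof (rule summable_ratio_test[of "1 / c" N])
    show "1 / c < 1" using c by simp
    fix k assume "N \<le> k"
    then have "c * v (Suc k) \<le> \<phi> k * v (Suc k)"
      using N[of k] pos[of "Suc k"] by (intro mult_right_mono) auto
    then have "c * v (Suc k) \<le> v k" using rec[of k] by simp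
    then show "norm (v (Suc k)) \<le> 1 / c * norm (v k)"
      using c pos[of k] pos[of "Suc k"] by (simp add: field_simps)
  qed
qed

lemma summable_weight_poly:
  fixes v :: "nat \<Rightarrow> real"
  assumes v: "summable v" "\<And>k. v k > 0" and q: "0 < q" "q < 1"
  shows "summable (\<lambda>k. v k * poly F (q ^ k))"
proof -
  have "(\<lambda>k. q ^ k) \<longlonglongrightarrow> 0" using q by (intro LIMSEQ_realpow_zero) auto
  then have "(\<lambda>k. poly F (q ^ k)) \<longlonglongrightarrow> poly F 0"
    by (rule tendsto_poly)
  then have "Bseq (\<lambda>k. poly F (q ^ k))"
    by (intro convergent_imp_Bseq convergentI)
  then obtain K where K: "\<And>k. norm (poly F (q ^ k)) \<le> K"
    by (auto simp: Bseq_def)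
  show ?thesis
  proof (rule summable_comparison_test')
    show "summable (\<lambda>k. v k * K)" using v(1) by (rule summable_mult2)
    show "norm (v k * poly F (q ^ k)) \<le> v k * K" if "0 \<le> k" for k
      using K[of k] v(2)[of k] by (simp add: abs_mult)
  qed
qed

section \<open>The functional and its orthogonal polynomials\<close>

text \<open>Keeps only the algebra of the weight. The quadratic factor in \<open>pearson\<close> is
  the ratio w(x/q)/w(x), and the equation is the substitution of x/q for x, free of boundary
  terms.\<close>

locale pearson_functional =
  fixes S :: "real poly \<Rightarrow> real" and q k1 k2 k3 :: real
    and p :: "nat \<Rightarrow> real poly" and a b :: "nat \<Rightarrow> real"
  assumes q_pos: "0 < q"
    and S_add: "S (F + G) = S F + S G"
    and S_smult: "S (smult d F) = d * S F"
    and pearson: "S (pcompose F [:0, q:] * G)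
      = S ([:1 - k1, - k3 / q, - k2 / q:] * F * pcompose G [:0, 1 / q:])"
    and deg: "degree (p n) = n" and lead_pos: "lead_coeff (p n) > 0"
    and orth: "S (pCons 0 (p m * p n)) = (if m = n then 1 else 0)"
    and a0: "a 0 = 0"
    and rec: "pCons 0 (p n) = smult (a (Suc n)) (p (Suc n)) + smult (b n) (p n)
      + smult (a n) (if n = 0 then 0 else p (n - 1))"
begin

definition \<gamma> :: "nat \<Rightarrow> real" where "\<gamma> n = coeff (p n) n"
text \<open>The quotient of the two top coefficients of \<open>p\<^sub>n\<close>; the shift by \<open>pCons 0\<close> makes it \<open>0\<close> for
  \<open>n = 0\<close>, where \<open>n - 1\<close> would truncate.\<close>

definition \<beta> :: "nat \<Rightarrow> real" where "\<beta> n = coeff (pCons 0 (p n)) n / \<gamma> n"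
definition c0 :: "nat \<Rightarrow> real" where "c0 n = coeff (p n) 0"
text \<open>Up to sign, the function of the second kind at 0.\<close>

definition s0 :: "nat \<Rightarrow> real" where "s0 n = S (p n)"

abbreviation L :: "real poly \<Rightarrow> real" where "L F \<equiv> S (pCons 0 F)"

lemma \<gamma>_pos: "\<gamma> n > 0"
  using lead_pos[of n] by (simp add: \<gamma>_def deg)

lemma \<gamma>_nz [simp]: "\<gamma> n \<noteq> 0"
  using \<gamma>_pos[of n] by simp

lemma coeff_p_above: "k > n \<Longrightarrow> coeff (p n) k = 0"
  by (simp add: coeff_eq_0 deg)

lemma S_0 [simp]: "S 0 = 0"
  using S_smult[of 0 0] by simp

lemma S_diff: "S (F - G) = S F - S G"
  using S_add[of "F - G" G] by simp

lemma L_add: "L (F + G) = L F + L G"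
  using S_add[of "pCons 0 F" "pCons 0 G"] by simp

lemma L_smult: "L (smult d F) = d * L F"
  using S_smult[of d "pCons 0 F"] by simp

lemma L_diff: "L (F - G) = L F - L G"
  using S_diff[of "pCons 0 F" "pCons 0 G"] by simp

text \<open>Subtracting a multiple of \<open>p m\<close> lowers the bound \<open>m\<close> by one.
  Bounding coefficients instead of the degree lets \<open>m = 0\<close> mean
  \<open>F = 0\<close>.\<close>

lemma L_orth:
  assumes "\<And>k. k \<ge> m \<Longrightarrow> coeff F k = 0" and "m \<le> n"
  shows "L (p n * F) = 0"
  using assms
proof (induction m arbitrary: F)
  case 0
  then have "F = 0" by (simp add: poly_eq_iff)
  then show ?case by simp
next
  case (Suc m)
  define G where "G = F - smult (coeff F m / \<gamma> m) (p m)"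
  have "coeff G k = 0" if "k \<ge> m" for k
  proof (cases "k = m")
    case True
    then show ?thesis by (simp add: G_def flip: \<gamma>_def)
  next
    case False
    then show ?thesis using that Suc.prems(1)[of k] by (simp add: G_def coeff_p_above)
  qed
  then have "L (p n * G) = 0" using Suc by simp
  moreover have "L (p n * G) = L (p n * F) - coeff F m / \<gamma> m * L (p n * p m)"
    by (simp add: G_def right_diff_distrib L_diff L_smult)
  ultimately show ?case using Suc.prems(2) orth[of n m] by simp
qed

lemma L_self: "L (p n * pCons 0 (p n)) = b n"
proof -
  have "p n * pCons 0 (p n) = smult (a (Suc n)) (p n * p (Suc n)) + smult (b n) (p n * p n)
      + smult (a n) (if n = 0 then 0 else p n * p (n - 1))"
    by (subst rec) (simp add: distrib_left)
  then show ?thesis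
    by (cases n) (simp_all only: L_add L_smult orth, simp_all add: orth)
qed

text \<open>Modulo degree below \<open>n\<close>, \<open>F\<close> is a combination of x p_n and
  p_n, on which \<open>L_self\<close> and \<open>orth\<close> give the values. The correction
  \<open>\<beta> n\<close> is the contribution of x p_n to the coefficient of x^n.\<close>

lemma L_top:
  assumes "\<And>k. k > Suc n \<Longrightarrow> coeff F k = 0"
  shows "L (p n * F) = (coeff F n + coeff F (Suc n) * (b n - \<beta> n)) / \<gamma> n"
proof -
  define t where "t = coeff F (Suc n) / \<gamma> n"
  define e where "e = (coeff F n - coeff F (Suc n) * \<beta> n) / \<gamma> n"
  define G where "G = F - smult t (pCons 0 (p n)) - smult e (p n)"
  have "coeff G k = 0" if "k \<ge> n" for k
  proof -
    from that have "k = n \<or> k = Suc n \<or> k > Suc n" by auto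
    then show ?thesis
    proof (elim disjE)
      assume "k = n"
      then show ?thesis
        by (simp add: G_def t_def e_def \<beta>_def del: smult_pCons flip: \<gamma>_def)
    next
      assume "k = Suc n"
      then show ?thesis
        by (simp add: G_def t_def coeff_p_above flip: \<gamma>_def)
    next
      assume "k > Suc n"
      then show ?thesis using assms[of k]
        by (simp add: G_def coeff_p_above coeff_pCons split: nat.split)
    qed
  qed
  then have "L (p n * G) = 0" by (rule L_orth) auto
  moreover have "L (p n * G) = L (p n * F) - t * L (p n * pCons 0 (p n)) - e * L (p n * p n)"
    unfolding G_def by (simp only: right_diff_distrib mult_smult_right L_diff L_smult)
  ultimately show ?thesis
    unfolding L_self orth
    by (simp add: t_def e_def add_divide_distrib diff_divide_distrib right_diff_distrib)
qed

text \<open>Write F = F(0) + x G. Then S (p_n x G) = L (p_n G) sees only the coefficient of x^n in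
  G.\<close>

lemma S_top:
  assumes "\<And>k. k > Suc n \<Longrightarrow> coeff F k = 0"
  shows "S (p n * F) = coeff F 0 * s0 n + coeff F (Suc n) / \<gamma> n"
proof (cases F)
  case (pCons d G)
  have G: "coeff G k = coeff F (Suc k)" for k using pCons by simp
  have "S (p n * F) = d * s0 n + L (p n * G)"
    by (simp add: pCons s0_def S_add S_smult)
  also have "L (p n * G) = coeff F (Suc n) / \<gamma> n"
    using assms by (subst L_top) (simp_all add: G)
  finally show ?thesis using pCons by simp
qed

section \<open>Coefficient recurrences and the Casoratian\<close>

lemma rec_lead: "\<gamma> n = a (Suc n) * \<gamma> (Suc n)"
  using arg_cong[OF rec, of "\<lambda>F. coeff F (Suc n)" n]
  by (simp add: coeff_p_above \<gamma>_def split: if_splits)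

lemma a_eq: "a (Suc n) = \<gamma> n / \<gamma> (Suc n)"
  by (simp add: rec_lead[of n])

lemma a_Suc_nz [simp]: "a (Suc n) \<noteq> 0"
  by (simp add: a_eq)

text \<open>Compares coefficients of x^n. Since \<open>b n\<close> is a difference of consecutive
  \<open>\<beta>\<close>, the subleading coefficients can later be traded for the
  \<open>b n\<close>.\<close>

lemma rec_sublead: "\<beta> n = \<beta> (Suc n) + b n"
proof -
  have "coeff (pCons 0 (p n)) n = a (Suc n) * coeff (p (Suc n)) n + b n * \<gamma> n"
    using arg_cong[OF rec, of "\<lambda>F. coeff F n" n]
    by (simp add: coeff_p_above \<gamma>_def split: if_splits)
  then show ?thesis
    by (simp add: \<beta>_def a_eq field_simps)
qed

lemma \<beta>_0: "\<beta> 0 = 0"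
  by (simp add: \<beta>_def)

text \<open>Apply \<open>S\<close> to the recurrence: S (x p_n) = L (p_n) vanishes for n > 0. The
  factor \<open>c0 n\<close> turns the inhomogeneity at n = 0 into L (p_0 p_0) = 1.\<close>

lemma rec_s: "b n * c0 n * s0 n + a n * (if n = 0 then 0 else c0 n * s0 (n - 1))
    + a (Suc n) * c0 n * s0 (Suc n) = (if n = 0 then 1 else 0)"
proof -
  have "c0 n * S (pCons 0 (p n)) = c0 n * (a (Suc n) * s0 (Suc n) + b n * s0 n
      + a n * (if n = 0 then 0 else s0 (n - 1)))"
    by (subst rec) (simp add: S_add S_smult s0_def)
  moreover have "c0 n * S (pCons 0 (p n)) = (if n = 0 then 1 else 0)"
  proof (cases "n = 0")
    case True
    have "p 0 = [:c0 0:]" using deg[of 0] by (auto simp: c0_def elim: degree_eq_zeroE)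
    then have "p 0 * p 0 = smult (c0 0) (p 0)" by simp
    then show ?thesis using True orth[of 0 0] by (simp add: L_smult)
  next
    case False
    then show ?thesis using L_orth[of 1 "[:1:]" n] by (simp add: coeff_pCons split: nat.splits)
  qed
  ultimately show ?thesis by (simp add: algebra_simps)
qed

text \<open>\<open>S_top\<close> evaluates S (p_n p_{n+1}) with either factor in the orthogonal
  role. Only with p_n in that role is there a top term, and it equals 1 / a_{n+1}.\<close>

lemma wronskian: "a (Suc n) * c0 n * s0 (Suc n) = a (Suc n) * c0 (Suc n) * s0 n + 1"
proof -
  have "S (p (Suc n) * p n) = c0 n * s0 (Suc n)"
    by (subst S_top) (simp_all add: coeff_p_above c0_def poly_0_coeff_0)
  moreover have "S (p n * p (Suc n)) = c0 (Suc n) * s0 n + \<gamma> (Suc n) / \<gamma> n"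
    by (subst S_top) (simp_all add: coeff_p_above c0_def poly_0_coeff_0 flip: \<gamma>_def)
  ultimately have "c0 n * s0 (Suc n) = c0 (Suc n) * s0 n + \<gamma> (Suc n) / \<gamma> n"
    by (simp add: mult.commute)
  then show ?thesis by (simp add: a_eq field_simps)
qed

section \<open>The Pearson equation on test pairs\<close>

lemma pearson_split: "S (G * pcompose F [:0, q:])
    = (1 - k1) * S (F * pcompose G [:0, 1 / q:]) - k3 / q * L (F * pcompose G [:0, 1 / q:])
      - k2 / q * L (F * pCons 0 (pcompose G [:0, 1 / q:]))"
proof -
  define H where "H = F * pcompose G [:0, 1 / q:]"
  have "S (G * pcompose F [:0, q:]) = S ([:1 - k1, - k3 / q, - k2 / q:] * H)"
    using pearson[of F G] by (simp only: H_def mult.assoc mult.commute[of G])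
  also have "[:1 - k1, - k3 / q, - k2 / q:] * H = smult (1 - k1) H
      + pCons 0 (smult (- k3 / q) H + smult (- k2 / q) (pCons 0 H))"
    by (simp add: algebra_simps)
  also have "S \<dots> = (1 - k1) * S H - k3 / q * L H - k2 / q * L (pCons 0 H)"
    unfolding S_add S_smult L_add L_smult by simp
  finally show ?thesis by (simp add: H_def)
qed

text \<open>Evaluates the integral in R_n: dilation keeps the value at 0, and the degree is too low
  for a top term. The next lemma does the same for r_n.\<close>

lemma S_dilated: "S (p n * pcompose (p n) [:0, 1 / q:]) = c0 n * s0 n"
  by (subst S_top) (simp_all add: coeff_pcompose_linear coeff_p_above c0_def poly_0_coeff_0)

lemma S_dilated_Suc: "S (p (Suc n) * pcompose (p n) [:0, 1 / q:]) = c0 n * s0 (Suc n)"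
  by (subst S_top) (simp_all add: coeff_pcompose_linear coeff_p_above c0_def poly_0_coeff_0)

lemma coeff_p_self: "coeff (p n) n = \<gamma> n"
  by (simp add: \<gamma>_def)

lemma coeff_pCons_p: "coeff (pCons 0 (p n)) n = \<beta> n * \<gamma> n"
  by (simp add: \<beta>_def)

lemma coeff_p_Suc: "coeff (p (Suc n)) n = \<beta> (Suc n) * \<gamma> (Suc n)"
  using coeff_pCons_p[of "Suc n"] by simp

text \<open>The pair F = p_{n+1}, G = p_n. On the right the \<open>k3\<close> term vanishes by
  orthogonality and the \<open>k2\<close> term keeps only a leading coefficient;
  \<open>wronskian\<close> then removes c0_{n+1} s0_n.\<close>

lemma a_square:
  "q ^ Suc n - 1 = - k1 * (a (Suc n) * c0 n * s0 (Suc n)) - k2 / q ^ Suc n * (a (Suc n))\<^sup>2"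
proof -
  have 1: "S (p n * pcompose (p (Suc n)) [:0, q:]) = c0 (Suc n) * s0 n + q ^ Suc n * \<gamma> (Suc n) / \<gamma> n"
    by (subst S_top) (simp_all add: coeff_pcompose_linear coeff_p_above c0_def poly_0_coeff_0 coeff_p_self)
  have 2: "L (p (Suc n) * pcompose (p n) [:0, 1 / q:]) = 0"
    by (subst L_top) (simp_all add: coeff_pcompose_linear coeff_p_above)
  have 3: "L (p (Suc n) * pCons 0 (pcompose (p n) [:0, 1 / q:])) = (1 / q) ^ n * \<gamma> n / \<gamma> (Suc n)"
    by (subst L_top)
       (simp_all add: coeff_pcompose_linear coeff_p_above coeff_p_self coeff_pCons split: nat.split)
  have "c0 (Suc n) * s0 n + q ^ Suc n / a (Suc n)
      = (1 - k1) * (c0 n * s0 (Suc n)) - k2 / q ^ Suc n * a (Suc n)"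
    using pearson_split[of "p n" "p (Suc n)"] unfolding 1 2 3 S_dilated_Suc
    by (simp add: a_eq power_divide)
  then have "a (Suc n) * (c0 (Suc n) * s0 n + q ^ Suc n / a (Suc n))
      = a (Suc n) * ((1 - k1) * (c0 n * s0 (Suc n)) - k2 / q ^ Suc n * a (Suc n))"
    by (simp only:)
  then have "a (Suc n) * c0 (Suc n) * s0 n + q ^ Suc n
      = (1 - k1) * (a (Suc n) * c0 n * s0 (Suc n)) - k2 / q ^ Suc n * (a (Suc n))\<^sup>2"
    by (simp add: algebra_simps power2_eq_square)
  then show ?thesis using wronskian[of n] by (simp add: algebra_simps)
qed

text \<open>The pair F = G = p_n. Both sides contain c0_n s0_n, with factors 1 and 1 - k1, so the
  difference is a multiple of \<open>k1\<close>.\<close>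

lemma R_sublead: "- k1 * (c0 n * s0 n) * q ^ Suc n = k3 + k2 * (q * \<beta> n - \<beta> (Suc n))"
proof -
  have 1: "S (p n * pcompose (p n) [:0, q:]) = c0 n * s0 n"
    by (subst S_top) (simp_all add: coeff_pcompose_linear coeff_p_above c0_def poly_0_coeff_0)
  have 2: "L (p n * pcompose (p n) [:0, 1 / q:]) = (1 / q) ^ n"
    by (subst L_top) (simp_all add: coeff_pcompose_linear coeff_p_above coeff_p_self)
  define F where "F = pCons 0 (pcompose (p n) [:0, 1 / q:])"
  have F: "coeff F (Suc n) = (1 / q) ^ n * \<gamma> n"
    by (simp add: F_def coeff_pcompose_linear coeff_p_self)
  \<comment> \<open>The coefficient of x^(n-1) in p_n(x/q) carries q^(1-n), hence the extra
    \<open>q\<close>; for n = 0 both sides are 0.\<close>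
  have F': "coeff F n = (1 / q) ^ n * q * \<beta> n * \<gamma> n"
    using q_pos by (cases n) (simp_all add: F_def coeff_pcompose_linear coeff_p_Suc \<beta>_0)
  have "L (p n * F) = (coeff F n + coeff F (Suc n) * (b n - \<beta> n)) / \<gamma> n"
    by (rule L_top)
       (simp add: F_def coeff_pcompose_linear coeff_p_above coeff_pCons split: nat.split)
  also have "\<dots> = (1 / q) ^ n * (q * \<beta> n - \<beta> (Suc n))"
  proof -
    have "b n - \<beta> n = - \<beta> (Suc n)" using rec_sublead[of n] by simp
    then show ?thesis unfolding F F' by (simp add: diff_divide_distrib right_diff_distrib)
  qed
  finally have 3: "L (p n * F) = (1 / q) ^ n * (q * \<beta> n - \<beta> (Suc n))" .
  have "c0 n * s0 n = (1 - k1) * (c0 n * s0 n) - k3 / q * (1 / q) ^ n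
      - k2 / q * ((1 / q) ^ n * (q * \<beta> n - \<beta> (Suc n)))"
    using pearson_split[of "p n" "p n"] unfolding 1 2 S_dilated 3[unfolded F_def] .
  then have "- k1 * (c0 n * s0 n) = (k3 + k2 * (q * \<beta> n - \<beta> (Suc n))) / q ^ Suc n"
    by (simp add: power_divide add_divide_distrib left_diff_distrib)
  then show ?thesis using q_pos by (simp only:) simp
qed

text \<open>The pair F = p_{n+1}, G = x p_n. As G vanishes at 0, no \<open>s0\<close> appears, and
  the result ties the subleading coefficients to \<open>a\<close> alone.\<close>

lemma sublead_relation:
  "(q ^ Suc n)\<^sup>2 * (1 - q) * \<beta> (Suc n)
    = - ((a (Suc n))\<^sup>2 * (k3 + k2 * (q * \<beta> n - \<beta> (Suc (Suc n)))))"
proof -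
  define F where "F = pcompose (p n) [:0, 1 / q:]"
  have F_above: "coeff F k = 0" if "k > n" for k
    using that by (simp add: F_def coeff_pcompose_linear coeff_p_above)
  have F_lead: "coeff F n = (1 / q) ^ n * \<gamma> n"
    by (simp add: F_def coeff_pcompose_linear coeff_p_self)
  have F_sub: "coeff (pCons 0 F) n = (1 / q) ^ n * q * \<beta> n * \<gamma> n"
    using q_pos
    by (cases n) (simp_all add: F_def coeff_pcompose_linear coeff_p_Suc \<beta>_0)
  have dil: "pcompose (pCons 0 (p n)) [:0, 1 / q:] = smult (1 / q) (pCons 0 F)"
    by (simp add: pcompose_pCons F_def)
  have 0: "S (pCons 0 (p n) * pcompose (p (Suc n)) [:0, q:])
      = q ^ n * (1 - q) * \<beta> (Suc n) / a (Suc n)"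
  proof -
    have "L (p n * pcompose (p (Suc n)) [:0, q:])
        = (q ^ n * (\<beta> (Suc n) * \<gamma> (Suc n)) + q ^ Suc n * \<gamma> (Suc n) * (b n - \<beta> n)) / \<gamma> n"
      by (subst L_top) (simp_all add: coeff_pcompose_linear coeff_p_above coeff_p_self coeff_p_Suc)
    also have "b n - \<beta> n = - \<beta> (Suc n)" using rec_sublead[of n] by simp
    finally show ?thesis by (simp add: a_eq field_simps)
  qed
  have 1: "S (p (Suc n) * smult (1 / q) (pCons 0 F)) = 0"
    using L_top[of "Suc n" F] F_above by (simp add: S_smult del: smult_pCons)
  have 2: "L (p (Suc n) * smult (1 / q) (pCons 0 F)) = 1 / q * ((1 / q) ^ n * a (Suc n))"
    using L_top[of "Suc n" "pCons 0 F"] F_above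
    by (simp add: L_smult F_lead a_eq coeff_pCons del: smult_pCons split: nat.splits)
  have 3: "L (p (Suc n) * pCons 0 (smult (1 / q) (pCons 0 F)))
      = 1 / q * ((1 / q) ^ n * a (Suc n) * (q * \<beta> n - \<beta> (Suc (Suc n))))"
  proof -
    have "L (p (Suc n) * pCons 0 (pCons 0 F))
        = (coeff (pCons 0 F) n + coeff F n * (b (Suc n) - \<beta> (Suc n))) / \<gamma> (Suc n)"
      using F_above by (subst L_top) (auto simp: coeff_pCons split: nat.splits)
    also have "\<dots> = (1 / q) ^ n * a (Suc n) * (q * \<beta> n - \<beta> (Suc (Suc n)))"
    proof -
      have "b (Suc n) - \<beta> (Suc n) = - \<beta> (Suc (Suc n))" using rec_sublead[of "Suc n"] by simp
      then show ?thesis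
        unfolding F_lead F_sub by (simp add: a_eq diff_divide_distrib right_diff_distrib)
    qed
    finally show ?thesis
      using L_smult[of "1 / q" "p (Suc n) * pCons 0 (pCons 0 F)"] by simp
  qed
  have "q ^ n * (1 - q) * \<beta> (Suc n) / a (Suc n)
      = - (k3 / q * (1 / q * ((1 / q) ^ n * a (Suc n))))
        - k2 / q * (1 / q * ((1 / q) ^ n * a (Suc n) * (q * \<beta> n - \<beta> (Suc (Suc n)))))"
    using pearson_split[of "pCons 0 (p n)" "p (Suc n)"] unfolding 0 dil 1 2 3 by simp
  then show ?thesis
    using q_pos by (simp add: field_simps power2_eq_square)
qed

section \<open>Relations between R_n, r_n, a_n and b_n\<close>

definition R0 :: "nat \<Rightarrow> real" where "R0 n = - k1 * (c0 n * s0 n)"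
definition r0 :: "nat \<Rightarrow> real" where
  "r0 n = (if n = 0 then 0 else - k1 * (a n * c0 (n - 1) * s0 n))"

lemma r0_Suc: "r0 (Suc n) = - k1 * (a (Suc n) * c0 n * s0 (Suc n))"
  by (simp add: r0_def)

text \<open>For n > 0 this adds \<open>rec_s\<close> at n and \<open>wronskian\<close> at n - 1,
  whose constant 1 yields \<open>k1\<close>. For n = 0 that 1 is the inhomogeneity of
  \<open>rec_s\<close>.\<close>

lemma r0_eq_R0: "r0 (Suc n) + r0 n = - b n * R0 n - k1"
proof (cases n)
  case 0
  have "a (Suc 0) * c0 0 * s0 (Suc 0) = 1 - b 0 * (c0 0 * s0 0)"
    using rec_s[of 0] by (simp add: a0 algebra_simps)
  then have "- k1 * (a (Suc 0) * c0 0 * s0 (Suc 0)) = - k1 * (1 - b 0 * (c0 0 * s0 0))"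
    by (simp only:)
  then show ?thesis using 0 by (simp add: r0_def R0_def algebra_simps)
next
  case (Suc m)
  have "a (Suc n) * c0 n * s0 (Suc n) + a n * c0 m * s0 n = 1 - b n * (c0 n * s0 n)"
    using rec_s[of n] wronskian[of m] Suc by (simp add: algebra_simps)
  then have "- k1 * (a (Suc n) * c0 n * s0 (Suc n) + a n * c0 m * s0 n)
      = - k1 * (1 - b n * (c0 n * s0 n))"
    by (simp only:)
  then show ?thesis using Suc by (simp add: r0_def R0_def algebra_simps)
qed

lemma a_square_r0: "k2 * (a n)\<^sup>2 = q ^ n * (1 - q ^ n + r0 n)"
proof (cases n)
  case 0
  then show ?thesis by (simp add: a0 r0_def)
next
  case (Suc m)
  then show ?thesis
    using a_square[of m] q_pos by (simp add: r0_Suc field_simps)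
qed

text \<open>By \<open>wronskian\<close>, r + k1 is r with the indices of \<open>c0\<close> and
  \<open>s0\<close> exchanged, so the four factors regroup.\<close>

lemma R0_prod: "(a (Suc n))\<^sup>2 * R0 (Suc n) * R0 n = r0 (Suc n) * (r0 (Suc n) + k1)"
proof -
  have *: "r0 (Suc n) + k1 = - k1 * (a (Suc n) * c0 (Suc n) * s0 n)"
    unfolding r0_Suc wronskian by (simp add: algebra_simps)
  show ?thesis
    unfolding *
    unfolding r0_Suc R0_def by (simp add: power2_eq_square mult_ac)
qed

lemma R0_sublead: "q ^ Suc n * R0 n = k3 + k2 * (q * \<beta> n - \<beta> (Suc n))"
  using R_sublead[of n] by (simp only: R0_def mult.commute[of "q ^ Suc n"])

text \<open>Subtracting consecutive instances of \<open>R0_sublead\<close> cancels \<open>k3\<close>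
  and leaves the \<open>\<beta>\<close> only in differences.\<close>

lemma R0_diff: "q * q ^ Suc n * R0 (Suc n) - q ^ Suc n * R0 n = k2 * (b (Suc n) - q * b n)"
proof -
  have "q * q ^ Suc n * R0 (Suc n) = k3 + k2 * (q * \<beta> (Suc n) - \<beta> (Suc (Suc n)))"
    using R0_sublead[of "Suc n"] by simp
  moreover have "b n = \<beta> n - \<beta> (Suc n)" "b (Suc n) = \<beta> (Suc n) - \<beta> (Suc (Suc n))"
    using rec_sublead[of n] rec_sublead[of "Suc n"] by simp_all
  ultimately show ?thesis
    by (simp only: R0_sublead) (simp add: algebra_simps)
qed

text \<open>Eliminates \<open>\<beta> (Suc n)\<close> between \<open>R0_sublead\<close> and
  \<open>sublead_relation\<close>. By \<open>a_square_r0\<close>, k2 a^2 contains the factor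
  q^(n+1), so one such power cancels.\<close>

lemma R0_linear:
  "q ^ Suc n * (q * q ^ Suc n * R0 (Suc n) - k3)
    = k2 * ((a (Suc n))\<^sup>2 * R0 n + (1 + r0 (Suc n)) * b (Suc n))"
proof -
  define Q A where "Q = q ^ Suc n" and "A = (a (Suc n))\<^sup>2"
  have Q: "Q \<noteq> 0" using q_pos by (simp add: Q_def)
  have A: "k2 * A = Q * (1 - Q + r0 (Suc n))"
    using a_square_r0[of "Suc n"] by (simp add: Q_def A_def)
  have R: "Q * R0 n = k3 + k2 * (q * \<beta> n - \<beta> (Suc n))"
    using R0_sublead[of n] by (simp add: Q_def)
  have R': "q * Q * R0 (Suc n) = k3 + k2 * (b (Suc n) - (1 - q) * \<beta> (Suc n))"
  proof -
    have "q * Q * R0 (Suc n) = k3 + k2 * (q * \<beta> (Suc n) - \<beta> (Suc (Suc n)))"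
      using R0_sublead[of "Suc n"] by (simp add: Q_def)
    also have "q * \<beta> (Suc n) - \<beta> (Suc (Suc n)) = b (Suc n) - (1 - q) * \<beta> (Suc n)"
      using rec_sublead[of "Suc n"] by (simp add: left_diff_distrib)
    finally show ?thesis .
  qed
  have "Q\<^sup>2 * (1 - q) * \<beta> (Suc n) = - (A * (k3 + k2 * (q * \<beta> n - \<beta> (Suc (Suc n)))))"
    using sublead_relation[of n] by (simp only: Q_def A_def)
  also have "\<dots> = - (A * (Q * R0 n) + (k2 * A) * b (Suc n))"
  proof -
    have *: "\<beta> (Suc (Suc n)) = \<beta> (Suc n) - b (Suc n)"
      using rec_sublead[of "Suc n"] by simp
    show ?thesis unfolding R * by (simp add: algebra_simps)
  qed
  also have "\<dots> = - (Q * (A * R0 n + (1 - Q + r0 (Suc n)) * b (Suc n)))"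
    unfolding A by (simp add: algebra_simps)
  finally have "Q * (Q * ((1 - q) * \<beta> (Suc n)))
      = Q * - (A * R0 n + (1 - Q + r0 (Suc n)) * b (Suc n))"
    by (simp add: power2_eq_square algebra_simps)
  then have \<beta>: "Q * ((1 - q) * \<beta> (Suc n)) = - (A * R0 n + (1 - Q + r0 (Suc n)) * b (Suc n))"
    using Q by (simp only: mult_left_cancel simp_thms)
  have "Q * (q * Q * R0 (Suc n) - k3) = k2 * (Q * b (Suc n) - Q * ((1 - q) * \<beta> (Suc n)))"
    unfolding R' by (simp add: algebra_simps)
  then show ?thesis
    unfolding \<beta> by (simp add: Q_def A_def algebra_simps)
qed

end

section \<open>Algebraic elimination\<close>

text \<open>Here \<open>Q\<close> is q^n and \<open>A\<close> is a_n^2; unprimed variables have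
  index n, one prime means n - 1, two primes mean n + 1.\<close>

lemma discrete_equation:
  fixes q Q k1 k2 k3 A b b' R R' r r' r'' f g :: real
  assumes nz: "q \<noteq> 0" "Q \<noteq> 0" "k2 \<noteq> 0"
    and A: "k2 * A = Q * (1 - Q + r)"
    and sum: "r'' + r = - b * R - k1" and sum': "r + r' = - b' * R' - k1"
    and diff: "q * Q * R - Q * R' = k2 * (b - q * b')"
    and lin: "Q * (q * Q * R - k3) = k2 * (A * R' + (1 + r) * b)"
    and prod: "A * R * R' = r * (r + k1)"
    and den: "Q - 1 - r \<noteq> 0" "r' * (Q - 1 - r) + (Q - 1) * (r + k1) \<noteq> 0"
    and f: "f = - (k2 * (1 / (q * Q)) * r * (r + k1)
        * (r * (Q - 1 - r'') + (Q - 1) * (r'' + k1)))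
        / ((Q - 1 - r) * (r' * (Q - 1 - r) + (Q - 1) * (r + k1)))"
    and g: "g = - k2 * (1 / (q * Q\<^sup>2)) * ((1 + r) * (1 + r'') - (1 - k1))"
  shows "R\<^sup>2 = f" and "f\<^sup>2 - 2 * f * g + g\<^sup>2 - k3\<^sup>2 * (1 / (q\<^sup>2 * Q\<^sup>2)) * f = 0"
proof -
  define N D where "N = r * (Q - 1 - r'') + (Q - 1) * (r'' + k1)"
    and "D = r' * (Q - 1 - r) + (Q - 1) * (r + k1)"
  have r'': "r'' = - r - b * R - k1" and r': "r' = - r - b' * R' - k1"
    using sum sum' by auto
  have prod': "Q * (1 - Q + r) * R * R' = k2 * (r * (r + k1))"
    using A prod by (metis mult.assoc)
  \<comment> \<open>\<open>diff\<close> gives k2 (q b' - b) = Q (R' - q R); with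
    \<open>prod'\<close> the two summands below become opposite. The multiplier k2 (1 - Q + r) is
    nonzero by \<open>den\<close>.\<close>
  have ND: "N * R' = q * R * D"
  proof -
    have "k2 * (1 - Q + r) * (N * R' - q * R * D)
        = (1 - Q + r) * ((Q - 1 - r) * (k2 * (q * b' - b)) * R * R'
            + k2 * (r * (r + k1)) * (R' - q * R))"
      unfolding N_def D_def r'' r' by (simp add: algebra_simps)
    also have "\<dots> = 0"
      using diff prod' by algebra
    finally show ?thesis using nz den by auto
  qed
  show R: "R\<^sup>2 = f"
  proof -
    \<comment> \<open>Multiplying \<open>prod'\<close> by \<open>N\<close> and using
      \<open>ND\<close> replaces R' by a multiple of R, so that only R^2 remains.\<close>
    have "k2 * (r * (r + k1)) * N = q * Q * (1 - Q + r) * R\<^sup>2 * D"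
      unfolding prod'[symmetric] using ND by algebra
    then show ?thesis
      using nz den unfolding f N_def[symmetric] D_def[symmetric]
      by (simp add: divide_simps) (algebra)
  qed
  \<comment> \<open>Multiply \<open>lin\<close> by \<open>R\<close>: \<open>prod\<close> then
    absorbs A R R', and the formula for r'' absorbs b R. The result is linear in R; squaring it
    gives the second degree.\<close>
  have "Q * (q * Q * R\<^sup>2 - k3 * R) = - k2 * ((1 + r) * (1 + r'') - (1 - k1))"
    using lin prod r'' by algebra
  then have "f - g = k3 / (q * Q) * R"
    using nz unfolding R[symmetric] g by (simp add: field_simps power2_eq_square)
  then have "(f - g)\<^sup>2 = k3\<^sup>2 * (1 / (q\<^sup>2 * Q\<^sup>2)) * f"
    unfolding R[symmetric] by (simp add: power_mult_distrib power_divide)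
  then show "f\<^sup>2 - 2 * f * g + g\<^sup>2 - k3\<^sup>2 * (1 / (q\<^sup>2 * Q\<^sup>2)) * f = 0"
    by (simp add: power2_diff algebra_simps)
qed

section \<open>From the weight to the functional\<close>

theorem theorem2p1:
  fixes q k1 k2 k3 :: real
    and w u :: "real \<Rightarrow> real"
    and p :: "nat \<Rightarrow> real poly"
    and a b R r f g :: "nat \<Rightarrow> real"
  assumes "0 < q" and "q < 1"
    and "q_weight q w"
    and "q_potential q w u"
    and "\<And>x. x \<noteq> 0 \<Longrightarrow> u x = k1 * q / (1 - q) * (1 / x) + (k2 * x + k3) / (1 - q)"
    and "k1 \<noteq> 0" and "k2 \<noteq> 0"
    and "q_orthonormal q w p"
    and "recurrence_coeffs p a b"
    and "\<And>n. R n = - k1 * q_integral q (\<lambda>y. poly (p n) y * poly (p n) (y / q) * (w y / y))"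
    and "r 0 = 0"
    and "\<And>n. n \<ge> 1 \<Longrightarrow>
           r n = - a n * k1 *
             q_integral q (\<lambda>y. poly (p n) y * poly (p (n - 1)) (y / q) * (w y / y))"
    and "\<And>n. n \<ge> 1 \<Longrightarrow>
           f n = - (k2 * q powi (- 1 - int n) * r n * (r n + k1)
                    * (r n * (q ^ n - 1 - r (n + 1)) + (q ^ n - 1) * (r (n + 1) + k1)))
                 / ((q ^ n - 1 - r n)
                    * (r (n - 1) * (q ^ n - 1 - r n) + (q ^ n - 1) * (r n + k1)))"
    and "\<And>n. n \<ge> 1 \<Longrightarrow>
           g n = - k2 * q powi (- 2 * int n - 1)
                 * ((1 + r n) * (1 + r (n + 1)) - (1 - k1))"
  shows "(\<forall>n. (a n)\<^sup>2 = q ^ n * (1 - q ^ n + r n) / k2)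
       \<and> (\<forall>n. r (n + 1) + r n = - b n * R n - k1)
       \<and> (\<forall>n\<ge>1. (q ^ n - 1 - r n)
                    * (r (n - 1) * (q ^ n - 1 - r n) + (q ^ n - 1) * (r n + k1)) \<noteq> 0 \<longrightarrow>
             (R n)\<^sup>2 = f n \<and>
             (f n)\<^sup>2 - 2 * f n * g n + (g n)\<^sup>2
               - k3\<^sup>2 * q powi (- 2 * int n - 2) * f n = 0)"
proof -
  note q = assms(1,2) and k1 = assms(6) and k2 = assms(7)
  define v where "v k = w (q ^ k)" for k
  define \<phi> where "\<phi> x = 1 - k1 - k3 * x - k2 * q * x\<^sup>2" for x
  have v_pos: "v k > 0" and v_lim: "v \<longlonglongrightarrow> 0" and w_end: "w (1 / q) = 0" for k
    using assms(3) by (auto simp: q_weight_def v_def[abs_def])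
  have w_rec: "w x = \<phi> x * w (q * x)" if x: "x = q powi k" "k \<ge> -1" for x and k :: int
  proof -
    have nz: "x \<noteq> 0" "q * x \<noteq> 0" "1 - q \<noteq> 0" using q x by auto
    have "- u (q * x) * w (q * x) = (w x - w (q * x)) / (x * (1 - q))"
      using assms(4) x by (simp add: q_potential_def q_diff_def)
    then have "w x - w (q * x) = - (u (q * x) * (x * (1 - q))) * w (q * x)"
      using nz by (simp add: nonzero_eq_divide_eq eq_commute[of _ "w x - _"])
    also have "u (q * x) * (x * (1 - q)) = k1 + k3 * x + k2 * q * x\<^sup>2"
    proof -
      have "u (q * x) = (k1 / x + k2 * (q * x) + k3) / (1 - q)"
        unfolding assms(5)[OF nz(2)] using nz q by (simp add: add_divide_distrib)
      then have "u (q * x) * (x * (1 - q)) = (k1 / x + k2 * (q * x) + k3) * x"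
        using nz by simp
      also have "\<dots> = k1 + k3 * x + k2 * q * x\<^sup>2"
        using nz by (simp add: distrib_right power2_eq_square)
      finally show ?thesis .
    qed
    finally show ?thesis by (simp add: \<phi>_def algebra_simps)
  qed
  have v_rec: "v k = \<phi> (q ^ k) * v (Suc k)" for k
    using w_rec[of "q ^ k" "int k"] by (simp add: v_def)
  \<comment> \<open>The relation at k = -1, where w(1/q) = 0: it removes the boundary term in the
    Pearson equation.\<close>
  have v_end: "\<phi> (1 / q) * v 0 = 0"
    using w_rec[of "1 / q" "-1"] w_end q by (simp add: v_def power_int_minus divide_inverse)
  have v_sum: "summable v"
  proof (rule summable_if_ratio_limit_neq_1[OF v_pos v_lim v_rec])
    have "(\<lambda>k. q ^ k) \<longlonglongrightarrow> 0" using q by (intro LIMSEQ_realpow_zero) auto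
    then have "(\<lambda>k. \<phi> (q ^ k)) \<longlonglongrightarrow> 1 - k1 - k3 * 0 - k2 * q * 0\<^sup>2"
      unfolding \<phi>_def by (intro tendsto_diff tendsto_mult tendsto_power tendsto_const)
    then show "(\<lambda>k. \<phi> (q ^ k)) \<longlonglongrightarrow> 1 - k1" by simp
  qed (use k1 in simp)
  \<comment> \<open>The factor 1/x in w(x)/x cancels the q^k of the q-integral, so the summation
    weight is w(q^k) itself.\<close>
  define S where "S F = (1 - q) * (\<Sum>k. v k * poly F (q ^ k))" for F
  have sum_F: "summable (\<lambda>k. v k * poly F (q ^ k))" for F
    using v_sum v_pos q by (rule summable_weight_poly)
  have S_integral: "q_integral q h = S F" if "\<And>k. q ^ k * h (q ^ k) = v k * poly F (q ^ k)" for h F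
    by (simp add: q_integral_def S_def that)
  interpret pearson_functional S q k1 k2 k3 p a b
  proof
    show "0 < q" by (rule q)
    show "S (F + G) = S F + S G" for F G
    proof -
      have "(\<Sum>k. v k * poly (F + G) (q ^ k))
          = (\<Sum>k. v k * poly F (q ^ k)) + (\<Sum>k. v k * poly G (q ^ k))"
        using suminf_add[OF sum_F[of F] sum_F[of G]] by (simp add: distrib_left)
      then show ?thesis by (simp only: S_def distrib_left)
    qed
    show "S (smult d F) = d * S F" for d F
      using suminf_mult[OF sum_F[of F], of d] by (simp add: S_def mult_ac)
    show "S (pcompose F [:0, q:] * G)
        = S ([:1 - k1, - k3 / q, - k2 / q:] * F * pcompose G [:0, 1 / q:])" for F G
    proof -
      let ?H = "[:1 - k1, - k3 / q, - k2 / q:] * F * pcompose G [:0, 1 / q:]"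
      have H: "poly ?H x = \<phi> (x / q) * poly F x * poly G (x / q)" for x
        using q by (simp add: poly_pcompose \<phi>_def field_simps power2_eq_square)
      \<comment> \<open>The summand at x = 1 contains \<open>\<phi> (1 / q) * v 0\<close>; dropping
        it makes the Pearson equation an index shift.\<close>
      have H0: "v 0 * poly ?H (q ^ 0) = 0"
        unfolding H using v_end by auto
      have HS: "v (Suc k) * poly ?H (q ^ Suc k)
          = v k * poly (pcompose F [:0, q:] * G) (q ^ k)" for k
        unfolding H using v_rec[of k] q by (simp add: poly_pcompose mult_ac)
      have "(\<Sum>k. v k * poly ?H (q ^ k))
          = v 0 * poly ?H (q ^ 0) + (\<Sum>k. v (Suc k) * poly ?H (q ^ Suc k))"
        using suminf_split_head[OF sum_F[of ?H]] by simp
      then show ?thesis unfolding S_def H0 HS by simp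
    qed
    show "degree (p n) = n" "lead_coeff (p n) > 0" for n
      using assms(8) unfolding q_orthonormal_def by blast+
    show "S (pCons 0 (p m * p n)) = (if m = n then 1 else 0)" for m n
    proof -
      have "q_integral q (\<lambda>x. poly (p m) x * poly (p n) x * w x) = S (pCons 0 (p m * p n))"
        by (rule S_integral) (simp add: v_def)
      then show ?thesis using assms(8) by (simp add: q_orthonormal_def)
    qed
    show "a 0 = 0" using assms(9) by (simp add: recurrence_coeffs_def)
    show "pCons 0 (p n) = smult (a (Suc n)) (p (Suc n)) + smult (b n) (p n)
        + smult (a n) (if n = 0 then 0 else p (n - 1))" for n
    proof (rule poly_ext)
      fix x
      show "poly (pCons 0 (p n)) x = poly (smult (a (Suc n)) (p (Suc n)) + smult (b n) (p n)
          + smult (a n) (if n = 0 then 0 else p (n - 1))) x"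
        using assms(9) by (simp add: recurrence_coeffs_def)
    qed
  qed
  have R: "R n = R0 n" for n
  proof -
    have "q_integral q (\<lambda>y. poly (p n) y * poly (p n) (y / q) * (w y / y))
        = S (p n * pcompose (p n) [:0, 1 / q:])"
      using q by (intro S_integral) (simp add: v_def poly_pcompose)
    then show ?thesis using assms(10)[of n] by (simp add: S_dilated R0_def)
  qed
  have r: "r n = r0 n" for n
  proof (cases n)
    case 0
    then show ?thesis using assms(11) by (simp add: r0_def)
  next
    case (Suc m)
    have "q_integral q (\<lambda>y. poly (p n) y * poly (p (n - 1)) (y / q) * (w y / y))
        = S (p n * pcompose (p m) [:0, 1 / q:])"
      using q Suc by (intro S_integral) (simp add: v_def poly_pcompose)
    then show ?thesis using assms(12)[of n] Suc by (simp add: S_dilated_Suc r0_Suc)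
  qed
  show ?thesis
  proof (intro conjI allI impI)
    show "(a n)\<^sup>2 = q ^ n * (1 - q ^ n + r n) / k2" for n
      using a_square_r0[of n] k2 by (simp add: r nonzero_eq_divide_eq mult.commute)
    show "r (n + 1) + r n = - b n * R n - k1" for n
      using r0_eq_R0[of n] by (simp add: r R)
    fix n :: nat
    assume n: "n \<ge> 1" and den: "(q ^ n - 1 - r n)
        * (r (n - 1) * (q ^ n - 1 - r n) + (q ^ n - 1) * (r n + k1)) \<noteq> 0"
    \<comment> \<open>The relations linking two indices are stated for \<open>Suc m\<close> and
      \<open>m\<close>, which here are n and n - 1.\<close>
    then obtain m where m: "n = Suc m" by (cases n) auto
    have powi: "q powi (- 1 - int n) = 1 / (q * q ^ n)"
      "q powi (- 2 * int n - 1) = 1 / (q * (q ^ n)\<^sup>2)"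
      "q powi (- 2 * int n - 2) = 1 / (q\<^sup>2 * (q ^ n)\<^sup>2)"
    proof -
      have "- 1 - int n = - int (Suc n)" "- 2 * int n - 1 = - int (Suc (n * 2))"
        "- 2 * int n - 2 = - int (2 + n * 2)" by simp_all
      then show "q powi (- 1 - int n) = 1 / (q * q ^ n)"
        "q powi (- 2 * int n - 1) = 1 / (q * (q ^ n)\<^sup>2)"
        "q powi (- 2 * int n - 2) = 1 / (q\<^sup>2 * (q ^ n)\<^sup>2)"
        by (simp_all only: power_int_minus power_int_of_nat power_add power_mult power_Suc inverse_eq_divide)
    qed
    note eq = discrete_equation[of q "q ^ n" k2 "(a n)\<^sup>2" "r n" "r (n + 1)" "b n" "R n" k1
      "r (n - 1)" "b (n - 1)" "R (n - 1)" k3 "f n" "g n"]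
    have "q \<noteq> 0" "q ^ n \<noteq> 0" using q by auto
    note eq = eq[OF this k2]
    have "k2 * (a n)\<^sup>2 = q ^ n * (1 - q ^ n + r n)"
      using a_square_r0[of n] by (simp add: r)
    note eq = eq[OF this]
    have "r (n + 1) + r n = - b n * R n - k1" "r n + r (n - 1) = - b (n - 1) * R (n - 1) - k1"
      using r0_eq_R0[of n] r0_eq_R0[of m] by (simp_all add: r R m)
    note eq = eq[OF this]
    have "q * q ^ n * R n - q ^ n * R (n - 1) = k2 * (b n - q * b (n - 1))"
      "q ^ n * (q * q ^ n * R n - k3) = k2 * ((a n)\<^sup>2 * R (n - 1) + (1 + r n) * b n)"
      "(a n)\<^sup>2 * R n * R (n - 1) = r n * (r n + k1)"
      using R0_diff[of m] R0_linear[of m] R0_prod[of m] unfolding m R r by simp_all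
    note eq = eq[OF this]
    have "q ^ n - 1 - r n \<noteq> 0" "r (n - 1) * (q ^ n - 1 - r n) + (q ^ n - 1) * (r n + k1) \<noteq> 0"
      using den by auto
    note eq = eq[OF this assms(13)[OF n, unfolded powi] assms(14)[OF n, unfolded powi]]
    show "(R n)\<^sup>2 = f n" by (rule eq)
    show "(f n)\<^sup>2 - 2 * f n * g n + (g n)\<^sup>2 - k3\<^sup>2 * q powi (- 2 * int n - 2) * f n = 0"
      unfolding powi by (rule eq)
  qed
qed

end
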